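(* Let $a<b$, and let $\hat f_k,\hat f:[a,b]\to L(R)$ ($k\ge1$). For each $0<\theta\le1$, on $[a,b]$, $$\hat f_k\xrightarrow{WU^{\theta}_{\alpha,\beta}}\hat f\ \Rightarrow\ \hat f_k\xrightarrow{WE^{\theta}_{\alpha,\beta}}\hat f\ \Rightarrow\ \hat f_k\xrightarrow{WP^{\theta}_{\alpha,\beta}}\hat f .$$ The inverse implications do not hold in general: there exist an order $\theta\in(0,1]$, an interval $[a,b]$, admissible data $(\alpha_n),(\beta_n),(t_k)$ and functions $\hat f_k,\hat f:[a,b]\to L(R)$ such that $\hat f_k\xrightarrow{WE^{\theta}_{\alpha,\beta}}\hat f$ but not $\hat f_k\xrightarrow{WU^{\theta}_{\alpha,\beta}}\hat f$; and there exist (possibly different) such objects with $\hat f_k\xrightarrow{WP^{\theta}_{\alpha,\beta}}\hat f$ but not $\hat f_k\xrightarrow{WE^{\theta}_{\alpha,\beta}}\hat f$.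
   Context: $L(R)$ is the set of fuzzy numbers: functions $\hat x:\mathbb{R}\to[0,1]$ that are normal (attain the value 1), fuzzy convex ($\hat x(\lambda s+(1-\lambda)t)\ge\min\{\hat x(s),\hat x(t)\}$ for $s,t\in\mathbb{R}$ and $\lambda\in[0,1]$), upper semicontinuous, and such that the closure $[\hat x]_0$ of $\{t:\hat x(t)>0\}$ is compact. For $0<r\le1$ the $r$-cut is $[\hat x]_r=\{t:\hat x(t)\ge r\}$; each cut is a compact interval $[\hat x]_r=[(\hat x)_r^-,(\hat x)_r^+]$, $r\in[0,1]$. The metric on $L(R)$ is $d(\hat x,\hat y)=\sup_{0\le r\le1}\max\{|(\hat x)_r^--(\hat y)_r^-|,|(\hat x)_r^+-(\hat y)_r^+|\}$. Admissible data: $(\alpha_n),(\beta_n)$ are non-decreasing sequences of positive numbers with $\beta_n\ge\alpha_n$ and $\beta_n-\alpha_n\to\infty$; $(t_k)_{k\ge1}$ is a sequence of non-negative reals with $\liminf_k t_k>0$; $T_{\alpha\beta(n)}=\sum_{k\in\mathbb{N},\,k\in[\alpha_n,\beta_n]}t_k$ (which is positive for all large $n$). The implications hold for any fixed admissible data. For $0<\theta\le1$ and functions $\hat f_k,\hat f:[a,b]\to L(R)$, with $|\cdot|$ denoting cardinality and $k$ ranging over $\mathbb{N}$: (WP) $\hat f_k\xrightarrow{WP^{\theta}_{\alpha,\beta}}\hat f$ (pointwise) means: for every $\varepsilon>0$ and each $x\in[a,b]$, $\lim_{n\to\infty}\frac{1}{T_{\alpha\beta(n)}^{\theta}}|\{k\le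 T_{\alpha\beta(n)}:t_kd(\hat f_k(x),\hat f(x))\ge\varepsilon\}|=0$. (WU) $\hat f_k\xrightarrow{WU^{\theta}_{\alpha,\beta}}\hat f$ (uniform) means: for every $\varepsilon>0$, $\lim_{n\to\infty}\frac{1}{T_{\alpha\beta(n)}^{\theta}}|\{k\le T_{\alpha\beta(n)}:t_kd(\hat f_k(x),\hat f(x))\ge\varepsilon\text{ for some }x\in[a,b]\}|=0$ (i.e. the exceptional $k$ are those for which "$t_kd(\hat f_k(x),\hat f(x))<\varepsilon$ for all $x\in[a,b]$" fails). (WE) $\hat f_k\xrightarrow{WE^{\theta}_{\alpha,\beta}}\hat f$ (equi-statistical) means: for every $\varepsilon>0$, $S_m(x)=\frac{1}{T_{\alpha\beta(m)}^{\theta}}|\{k\le T_{\alpha\beta(m)}:t_kd(\hat f_k(x),\hat f(x))\ge\varepsilon\}|$ converges to $0$ as $m\to\infty$ uniformly in $x\in[a,b]$. *)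

theory Defs
  imports "HOL-Analysis.Analysis"
begin

definition upper_semicontinuous :: "(real \<Rightarrow> real) \<Rightarrow> bool" where
  "upper_semicontinuous u \<longleftrightarrow> (\<forall>t. \<forall>c > u t. eventually (\<lambda>s. u s < c) (nhds t))"

definition fuzzy_numbers :: "(real \<Rightarrow> real) set" where
  "fuzzy_numbers = {u.
     range u \<subseteq> {0..1} \<and>
     (\<exists>t. u t = 1) \<and>
     (\<forall>s t. \<forall>l\<in>{0..1}. u (l * s + (1 - l) * t) \<ge> min (u s) (u t)) \<and>
     upper_semicontinuous u \<and>
     compact (closure {t. u t > 0})}"

definition fuzzy_cut :: "(real \<Rightarrow> real) \<Rightarrow> real \<Rightarrow> real set" where
  "fuzzy_cut u r = (if r = 0 then closure {t. u t > 0} else {t. u t \<ge> r})"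

definition cut_lower :: "(real \<Rightarrow> real) \<Rightarrow> real \<Rightarrow> real" where
  "cut_lower u r = Inf (fuzzy_cut u r)"

definition cut_upper :: "(real \<Rightarrow> real) \<Rightarrow> real \<Rightarrow> real" where
  "cut_upper u r = Sup (fuzzy_cut u r)"

(* For fuzzy numbers Inf, Sup are the endpoints of the cut (fuzzy_cut_compact_interval) and the
   real supremum below is over a bounded set (fuzzy_dist_bdd_above). *)
definition fuzzy_dist :: "(real \<Rightarrow> real) \<Rightarrow> (real \<Rightarrow> real) \<Rightarrow> real" where
  "fuzzy_dist u v = (SUP r\<in>{0..1}.
     max \<bar>cut_lower u r - cut_lower v r\<bar> \<bar>cut_upper u r - cut_upper v r\<bar>)"

(* All sequences are indexed by the positive integers; values at index 0 are irrelevant.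
   The lower limit is taken in the extended reals because t need not be bounded.
   The weight sums below may vanish for finitely many n; the quotients are then 0. *)
definition admissible :: "(nat \<Rightarrow> real) \<Rightarrow> (nat \<Rightarrow> real) \<Rightarrow> (nat \<Rightarrow> real) \<Rightarrow> bool" where
  "admissible \<alpha> \<beta> t \<longleftrightarrow>
     mono_on {1..} \<alpha> \<and> mono_on {1..} \<beta> \<and>
     (\<forall>n\<ge>1. 0 < \<alpha> n \<and> 0 < \<beta> n \<and> \<alpha> n \<le> \<beta> n) \<and>
     filterlim (\<lambda>n. \<beta> n - \<alpha> n) at_top sequentially \<and>
     (\<forall>k\<ge>1. 0 \<le> t k) \<and>
     liminf (\<lambda>k. ereal (t k)) > 0"

definition weight_sum :: "(nat \<Rightarrow> real) \<Rightarrow> (nat \<Rightarrow> real) \<Rightarrow> (nat \<Rightarrow> real) \<Rightarrow> nat \<Rightarrow> real" where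
  "weight_sum \<alpha> \<beta> t n = (\<Sum>k | 1 \<le> k \<and> real k \<in> {\<alpha> n..\<beta> n}. t k)"

definition WP_conv :: "real \<Rightarrow> (nat \<Rightarrow> real) \<Rightarrow> (nat \<Rightarrow> real) \<Rightarrow> (nat \<Rightarrow> real) \<Rightarrow> real \<Rightarrow> real \<Rightarrow>
    (nat \<Rightarrow> real \<Rightarrow> real \<Rightarrow> real) \<Rightarrow> (real \<Rightarrow> real \<Rightarrow> real) \<Rightarrow> bool" where
  "WP_conv \<theta> \<alpha> \<beta> t a b fs f \<longleftrightarrow>
     (\<forall>\<epsilon>>0. \<forall>x\<in>{a..b}.
        (\<lambda>n. 1 / weight_sum \<alpha> \<beta> t n powr \<theta> *
           real (card {k. 1 \<le> k \<and> real k \<le> weight_sum \<alpha> \<beta> t n \<and>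
                          t k * fuzzy_dist (fs k x) (f x) \<ge> \<epsilon>})) \<longlonglongrightarrow> 0)"

definition WU_conv :: "real \<Rightarrow> (nat \<Rightarrow> real) \<Rightarrow> (nat \<Rightarrow> real) \<Rightarrow> (nat \<Rightarrow> real) \<Rightarrow> real \<Rightarrow> real \<Rightarrow>
    (nat \<Rightarrow> real \<Rightarrow> real \<Rightarrow> real) \<Rightarrow> (real \<Rightarrow> real \<Rightarrow> real) \<Rightarrow> bool" where
  "WU_conv \<theta> \<alpha> \<beta> t a b fs f \<longleftrightarrow>
     (\<forall>\<epsilon>>0.
        (\<lambda>n. 1 / weight_sum \<alpha> \<beta> t n powr \<theta> *
           real (card {k. 1 \<le> k \<and> real k \<le> weight_sum \<alpha> \<beta> t n \<and>
                          (\<exists>x\<in>{a..b}. t k * fuzzy_dist (fs k x) (f x) \<ge> \<epsilon>)})) \<longlonglongrightarrow> 0)"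

definition WE_conv :: "real \<Rightarrow> (nat \<Rightarrow> real) \<Rightarrow> (nat \<Rightarrow> real) \<Rightarrow> (nat \<Rightarrow> real) \<Rightarrow> real \<Rightarrow> real \<Rightarrow>
    (nat \<Rightarrow> real \<Rightarrow> real \<Rightarrow> real) \<Rightarrow> (real \<Rightarrow> real \<Rightarrow> real) \<Rightarrow> bool" where
  "WE_conv \<theta> \<alpha> \<beta> t a b fs f \<longleftrightarrow>
     (\<forall>\<epsilon>>0.
        uniform_limit {a..b}
          (\<lambda>m x. 1 / weight_sum \<alpha> \<beta> t m powr \<theta> *
             real (card {k. 1 \<le> k \<and> real k \<le> weight_sum \<alpha> \<beta> t m \<and>
                            t k * fuzzy_dist (fs k x) (f x) \<ge> \<epsilon>}))
          (\<lambda>x. 0) sequentially)"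

definition fuzzy_setting :: "real \<Rightarrow> (nat \<Rightarrow> real) \<Rightarrow> (nat \<Rightarrow> real) \<Rightarrow> (nat \<Rightarrow> real) \<Rightarrow> real \<Rightarrow> real \<Rightarrow>
    (nat \<Rightarrow> real \<Rightarrow> real \<Rightarrow> real) \<Rightarrow> (real \<Rightarrow> real \<Rightarrow> real) \<Rightarrow> bool" where
  "fuzzy_setting \<theta> \<alpha> \<beta> t a b fs f \<longleftrightarrow>
     0 < \<theta> \<and> \<theta> \<le> 1 \<and> a < b \<and> admissible \<alpha> \<beta> t \<and>
     (\<forall>k\<ge>1. fs k \<in> {a..b} \<rightarrow> fuzzy_numbers) \<and> f \<in> {a..b} \<rightarrow> fuzzy_numbers"

lemma fuzzy_cut_subset:
  assumes "0 \<le> r" shows "fuzzy_cut u r \<subseteq> fuzzy_cut u 0"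
proof (cases "r = 0")
  case False
  then have "{t. u t \<ge> r} \<subseteq> {t. u t > 0}" using assms by auto
  also have "\<dots> \<subseteq> closure {t. u t > 0}" by (rule closure_subset)
  finally show ?thesis using False by (simp add: fuzzy_cut_def)
qed simp

lemma fuzzy_cut_nonempty:
  assumes "u \<in> fuzzy_numbers" "r \<in> {0..1}" shows "fuzzy_cut u r \<noteq> {}"
proof -
  obtain t where t: "u t = 1" using assms(1) unfolding fuzzy_numbers_def by blast
  have "t \<in> fuzzy_cut u r"
  proof (cases "r = 0")
    case True
    have "t \<in> {t. u t > 0}" using t by simp
    also have "\<dots> \<subseteq> closure {t. u t > 0}" by (rule closure_subset)
    finally show ?thesis using True by (simp add: fuzzy_cut_def)
  qed (use t assms(2) in \<open>simp add: fuzzy_cut_def\<close>)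
  then show ?thesis by blast
qed

lemma fuzzy_cut_compact_interval:
  assumes u: "u \<in> fuzzy_numbers" and r: "r \<in> {0..1}"
  shows "fuzzy_cut u r = {cut_lower u r..cut_upper u r}" "cut_lower u r \<le> cut_upper u r"
proof -
  have usc: "\<And>t c. u t < c \<Longrightarrow> \<exists>S. open S \<and> t \<in> S \<and> (\<forall>s\<in>S. u s < c)"
    using u unfolding fuzzy_numbers_def upper_semicontinuous_def eventually_nhds by blast
  have cpt: "compact (fuzzy_cut u 0)"
    using u unfolding fuzzy_numbers_def fuzzy_cut_def by simp
  have cvx: "\<And>s t l. l \<in> {0..1} \<Longrightarrow> u (l * s + (1 - l) * t) \<ge> min (u s) (u t)"
    using u unfolding fuzzy_numbers_def by blast
  have "open {t. u t < r}"
  proof (subst open_subopen, intro ballI)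
    fix t assume "t \<in> {t. u t < r}"
    then obtain S where "open S" "t \<in> S" "\<forall>s\<in>S. u s < r" using usc[of t r] by blast
    then show "\<exists>T. open T \<and> t \<in> T \<and> T \<subseteq> {t. u t < r}" by (intro exI[of _ S]) auto
  qed
  moreover have "- {t. u t \<ge> r} = {t. u t < r}" by auto
  ultimately have "closed {t. u t \<ge> r}" by (simp add: closed_def)
  then have "closed (fuzzy_cut u r)" by (simp add: fuzzy_cut_def)
  moreover have "fuzzy_cut u 0 \<inter> fuzzy_cut u r = fuzzy_cut u r"
    using fuzzy_cut_subset[of r u] r by (simp add: Int_absorb1)
  ultimately have c: "compact (fuzzy_cut u r)"
    using compact_Int_closed[OF cpt, of "fuzzy_cut u r"] by simp
  have m: "min (u s) (u t) \<le> u ((1 - l) *\<^sub>R s + l *\<^sub>R t)" if "0 \<le> l" "l \<le> 1" for s t l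
    using cvx[of "1 - l" s t] that by simp
  have "convex {t. u t > 0}"
    unfolding convex_alt
  proof (intro ballI allI impI)
    fix s t l assume "s \<in> {t. u t > 0}" "t \<in> {t. u t > 0}" "0 \<le> l \<and> l \<le> (1::real)"
    then show "(1 - l) *\<^sub>R s + l *\<^sub>R t \<in> {t. u t > 0}" using m[of l s t] by simp
  qed
  moreover have "convex {t. u t \<ge> r}"
    unfolding convex_alt
  proof (intro ballI allI impI)
    fix s t l assume "s \<in> {t. u t \<ge> r}" "t \<in> {t. u t \<ge> r}" "0 \<le> l \<and> l \<le> (1::real)"
    then show "(1 - l) *\<^sub>R s + l *\<^sub>R t \<in> {t. u t \<ge> r}" using m[of l s t] by simp
  qed
  ultimately have "convex (fuzzy_cut u r)"
    unfolding fuzzy_cut_def by simp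
  then have "connected (fuzzy_cut u r)" by (rule convex_connected)
  then obtain p q where pq: "fuzzy_cut u r = {p..q}"
    using c connected_compact_interval_1[of "fuzzy_cut u r"] by blast
  have "p \<le> q" using fuzzy_cut_nonempty[OF u r] unfolding pq by simp
  then show "fuzzy_cut u r = {cut_lower u r..cut_upper u r}" "cut_lower u r \<le> cut_upper u r"
    by (simp_all add: cut_lower_def cut_upper_def pq)
qed

lemma fuzzy_dist_bdd_above:
  assumes u: "u \<in> fuzzy_numbers" and v: "v \<in> fuzzy_numbers"
  shows "bdd_above ((\<lambda>r. max \<bar>cut_lower u r - cut_lower v r\<bar> \<bar>cut_upper u r - cut_upper v r\<bar>) ` {0..1})"
proof -
  have b: "cut_lower w 0 \<le> cut_lower w r \<and> cut_lower w r \<le> cut_upper w r \<and> cut_upper w r \<le> cut_upper w 0"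
    if w: "w \<in> fuzzy_numbers" and r: "r \<in> {0..1}" for w r
  proof -
    have "{cut_lower w r..cut_upper w r} \<subseteq> {cut_lower w 0..cut_upper w 0}"
      using fuzzy_cut_subset[of r w] r fuzzy_cut_compact_interval(1)[OF w r]
        fuzzy_cut_compact_interval(1)[OF w, of 0] by simp
    then show ?thesis using fuzzy_cut_compact_interval(2)[OF w r] by simp
  qed
  define M where "M = max (cut_upper u 0 - cut_lower v 0) (cut_upper v 0 - cut_lower u 0)"
  have M: "cut_upper u 0 - cut_lower v 0 \<le> M" "cut_upper v 0 - cut_lower u 0 \<le> M"
    unfolding M_def by simp_all
  show ?thesis
  proof (rule bdd_aboveI2)
    fix r :: real assume r: "r \<in> {0..1}"
    have "\<bar>cut_lower u r - cut_lower v r\<bar> \<le> M" "\<bar>cut_upper u r - cut_upper v r\<bar> \<le> M"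
      unfolding abs_le_iff using b[OF u r] b[OF v r] M by linarith+
    then show "max \<bar>cut_lower u r - cut_lower v r\<bar> \<bar>cut_upper u r - cut_upper v r\<bar> \<le> M"
      by simp
  qed
qed

end

theory Submission
  imports Defs
begin

text \<open>For each \<open>x\<close> the exceptional set is contained in the uniform exceptional set, so the latter's
  density bounds the former's uniformly in \<open>x\<close>. For the converses take unit weights on \<open>[1, n]\<close>, order 1, and crisp fuzzy numbers
  0 and 1 on \<open>[0, 1]\<close>. A spike of \<open>f\<^sub>k\<close> at the single point \<open>1/k\<close> is met by each \<open>x\<close> at most once,
  yet every \<open>k\<close> has one; a spike of \<open>f\<^sub>k\<close> on \<open>(0, 1/k]\<close> is met by each \<open>x\<close> only finitely often,
  yet \<open>x = 1/n\<close> meets the first \<open>n\<close> of them.\<close>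

text \<open>Every set counted here lies below a real bound. Finiteness has to be known before
  cardinalities are compared, since \<open>card\<close> of an infinite set is 0.\<close>

lemma finite_real_nat_atMost: "finite {n. real n \<le> u}"
  by (rule finite_subset[of _ "{..nat \<lfloor>u\<rfloor>}"]) (auto simp: le_nat_floor)

lemma WU_conv_imp_WE_conv:
  assumes "WU_conv \<theta> \<alpha> \<beta> t a b fs f"
  shows "WE_conv \<theta> \<alpha> \<beta> t a b fs f"
  unfolding WE_conv_def
proof (intro allI impI)
  fix \<epsilon> :: real assume "\<epsilon> > 0"
  let ?W = "weight_sum \<alpha> \<beta> t"
  let ?E = "\<lambda>m x. {k. 1 \<le> k \<and> real k \<le> ?W m \<and> t k * fuzzy_dist (fs k x) (f x) \<ge> \<epsilon>}"
  let ?U = "\<lambda>m. {k. 1 \<le> k \<and> real k \<le> ?W m \<and> (\<exists>x\<in>{a..b}. t k * fuzzy_dist (fs k x) (f x) \<ge> \<epsilon>)}"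
  show "uniform_limit {a..b} (\<lambda>m x. 1 / ?W m powr \<theta> * real (card (?E m x))) (\<lambda>x. 0) sequentially"
  proof (rule uniform_limit_null_comparison)
    have "(\<lambda>m. 1 / ?W m powr \<theta> * real (card (?U m))) \<longlonglongrightarrow> 0"
      using assms \<open>\<epsilon> > 0\<close> unfolding WU_conv_def by blast
    \<comment> \<open>The dominating quotient does not depend on \<open>x\<close>, so its plain
      limit is already a uniform one.\<close>
    then show "uniform_limit {a..b} (\<lambda>m x. 1 / ?W m powr \<theta> * real (card (?U m))) (\<lambda>_. 0) sequentially"
      by (simp add: uniform_limit_iff tendsto_iff eventually_mono)
    show "\<forall>\<^sub>F m in sequentially. \<forall>x\<in>{a..b}.
        norm (1 / ?W m powr \<theta> * real (card (?E m x))) \<le> 1 / ?W m powr \<theta> * real (card (?U m))"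
    proof (intro always_eventually allI ballI)
      fix m x assume "x \<in> {a..b}"
      have "?U m \<subseteq> {k. real k \<le> ?W m}" by blast
      then have "finite (?U m)"
        using finite_subset finite_real_nat_atMost by blast
      then have "card (?E m x) \<le> card (?U m)"
        using \<open>x \<in> {a..b}\<close> by (intro card_mono) blast+
      \<comment> \<open>The factor in front is never negative, also where the weight sum vanishes
        and the quotient is 0 by convention.\<close>
      then show "norm (1 / ?W m powr \<theta> * real (card (?E m x))) \<le> 1 / ?W m powr \<theta> * real (card (?U m))"
        by (simp add: divide_right_mono)
    qed
  qed
qed

lemma WE_conv_imp_WP_conv:
  assumes "WE_conv \<theta> \<alpha> \<beta> t a b fs f"
  shows "WP_conv \<theta> \<alpha> \<beta> t a b fs f"
  unfolding WP_conv_def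
proof (intro allI impI ballI)
  fix \<epsilon> x :: real assume "\<epsilon> > 0" "x \<in> {a..b}"
  have "uniform_limit {a..b} (\<lambda>m x. 1 / weight_sum \<alpha> \<beta> t m powr \<theta> *
      real (card {k. 1 \<le> k \<and> real k \<le> weight_sum \<alpha> \<beta> t m \<and>
        t k * fuzzy_dist (fs k x) (f x) \<ge> \<epsilon>})) (\<lambda>x. 0) sequentially"
    using assms \<open>\<epsilon> > 0\<close> unfolding WE_conv_def by blast
  from tendsto_uniform_limitI[OF this \<open>x \<in> {a..b}\<close>]
  show "(\<lambda>m. 1 / weight_sum \<alpha> \<beta> t m powr \<theta> *
      real (card {k. 1 \<le> k \<and> real k \<le> weight_sum \<alpha> \<beta> t m \<and>
        t k * fuzzy_dist (fs k x) (f x) \<ge> \<epsilon>})) \<longlonglongrightarrow> 0" .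
qed

lemma indicator_singleton_fuzzy_number: "indicator {c} \<in> fuzzy_numbers"
proof -
  have "upper_semicontinuous (indicator {c})"
    unfolding upper_semicontinuous_def
  proof (intro allI impI)
    fix t v :: real assume v: "indicator {c} t < v"
    show "\<forall>\<^sub>F s in nhds t. indicator {c} s < v"
    \<comment> \<open>At \<open>c\<close> the value is the maximum 1, so a bound above it holds
      everywhere; elsewhere the indicator is 0 on a neighbourhood avoiding \<open>c\<close>.\<close>
    proof (cases "t = c")
      case True
      then have "v > 1" using v by simp
      then show ?thesis
        by (intro always_eventually) (auto simp: indicator_def)
    next
      case False
      then have "\<forall>\<^sub>F s in nhds t. s \<noteq> c" by (rule t1_space_nhds)
      then show ?thesis by eventually_elim (use v False in simp)
    qed
  qed
  moreover have "{t. indicator {c} t > (0::real)} = {c}"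
    by (auto simp: indicator_def)
  ultimately show ?thesis
    unfolding fuzzy_numbers_def by (auto simp: indicator_def algebra_simps)
qed

text \<open>Every cut of a crisp number is the same single point, the support closure at level 0
  included, so the supremum is over a constant. The reals thus embed isometrically.\<close>

lemma fuzzy_dist_indicator_singleton:
  "fuzzy_dist (indicator {c}) (indicator {d}) = \<bar>c - d\<bar>"
proof -
  have cut: "fuzzy_cut (indicator {e}) r = {e}" if "r \<in> {0..1}" for e r
  proof -
    have "{t. indicator {e} t > (0::real)} = {e}"
      by (auto simp: indicator_def)
    moreover have "{t. indicator {e} t \<ge> r} = {e}" if "r \<noteq> 0"
      using that \<open>r \<in> {0..1}\<close> by (auto simp: indicator_def)
    ultimately show ?thesis by (simp add: fuzzy_cut_def)
  qed
  have "fuzzy_dist (indicator {c}) (indicator {d}) = (SUP r\<in>{0..1::real}. \<bar>c - d\<bar>)"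
    unfolding fuzzy_dist_def by (rule SUP_cong) (simp_all add: cut_lower_def cut_upper_def cut)
  then show ?thesis by simp
qed

lemma weight_sum_unit: "weight_sum (\<lambda>_. 1) real (\<lambda>_. 1) n = real n"
proof -
  have "{k. 1 \<le> k \<and> real k \<in> {1..real n}} = {1..n}" by auto
  then show ?thesis by (simp add: weight_sum_def)
qed

text \<open>Both counterexamples are instances: \<open>P k x\<close> says that the
  \<open>k\<close>-th function has a spike at \<open>x\<close>, and only this predicate differs
  between them.\<close>

lemma fuzzy_setting_unit_crisp:
  "fuzzy_setting 1 (\<lambda>_. 1) real (\<lambda>_. 1) 0 1
     (\<lambda>k x. indicator {of_bool (P k x)}) (\<lambda>x. indicator {0})"
proof -
  have "filterlim (\<lambda>n. real n - 1) at_top sequentially"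
    using filterlim_tendsto_add_at_top[OF tendsto_const[of "-1"] filterlim_real_sequentially]
    by simp
  moreover have "liminf (\<lambda>k. ereal 1) = 1"
    by (simp add: Liminf_const one_ereal_def)
  ultimately show ?thesis
    by (simp add: fuzzy_setting_def admissible_def mono_on_def indicator_singleton_fuzzy_number)
qed

text \<open>The distance is 1 at a spike and 0 elsewhere, so a threshold above 1 is never
  reached.\<close>

lemma fuzzy_dist_crisp_ge_iff:
  assumes "\<epsilon> > 0"
  shows "fuzzy_dist (indicator {of_bool p}) (indicator {0}) \<ge> \<epsilon> \<longleftrightarrow> p \<and> \<epsilon> \<le> 1"
  using assms by (cases p) (simp_all add: fuzzy_dist_indicator_singleton)

text \<open>The product form of \<open>x = 1 / k\<close> avoids division and is false at
  \<open>k = 0\<close>.\<close>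

lemma WE_conv_not_WU_conv_example:
  fixes P :: "nat \<Rightarrow> real \<Rightarrow> bool"
  defines "P \<equiv> \<lambda>k x. x * real k = 1"
  defines "fs \<equiv> \<lambda>k x. indicator {of_bool (P k x)}" and "f \<equiv> \<lambda>x::real. indicator {0}"
  shows "WE_conv 1 (\<lambda>_. 1) real (\<lambda>_. 1) 0 1 fs f"
    and "\<not> WU_conv 1 (\<lambda>_. 1) real (\<lambda>_. 1) 0 1 fs f"
proof -
  show "WE_conv 1 (\<lambda>_. 1) real (\<lambda>_. 1) 0 1 fs f"
    unfolding WE_conv_def weight_sum_unit
  proof (intro allI impI)
    fix \<epsilon> :: real assume "\<epsilon> > 0"
    let ?E = "\<lambda>m x. {k. 1 \<le> k \<and> real k \<le> real m \<and> 1 * fuzzy_dist (fs k x) (f x) \<ge> \<epsilon>}"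
    show "uniform_limit {0..1} (\<lambda>m x. 1 / real m powr 1 * real (card (?E m x))) (\<lambda>x. 0) sequentially"
    proof (rule uniform_limit_null_comparison)
      show "uniform_limit {0..1::real} (\<lambda>m x. 1 / real m) (\<lambda>_. 0) sequentially"
        using lim_1_over_n[where 'a = real]
        by (simp add: uniform_limit_iff tendsto_iff eventually_mono)
      \<comment> \<open>An index counted at \<open>x\<close> is the reciprocal of \<open>x\<close>,
        hence unique; this gives the bound \<open>1 / m\<close> for all \<open>x\<close> at
        once.\<close>
      have "card (?E m x) \<le> 1" for m x
      proof (subst One_nat_def, subst card_le_Suc0_iff_eq)
        show "finite (?E m x)"
          by (rule finite_subset[of _ "{..m}"]) auto
        have "x * real k = 1" if "k \<in> ?E m x" for k
          using that by (simp add: fs_def f_def P_def fuzzy_dist_crisp_ge_iff[OF \<open>\<epsilon> > 0\<close>])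
        moreover have "i = j" if "x * real i = 1" "x * real j = 1" for i j
        proof -
          have "x \<noteq> 0" using that by auto
          moreover have "x * real i = x * real j" using that by simp
          ultimately show "i = j" by simp
        qed
        ultimately show "\<forall>i\<in>?E m x. \<forall>j\<in>?E m x. i = j" by blast
      qed
      then show "\<forall>\<^sub>F m in sequentially. \<forall>x\<in>{0..1}.
          norm (1 / real m powr 1 * real (card (?E m x))) \<le> 1 / real m"
        by (intro always_eventually allI ballI) (simp add: divide_right_mono)
    qed
  qed
  show "\<not> WU_conv 1 (\<lambda>_. 1) real (\<lambda>_. 1) 0 1 fs f"
  proof
    assume "WU_conv 1 (\<lambda>_. 1) real (\<lambda>_. 1) 0 1 fs f"
    then have lim: "(\<lambda>n. 1 / real n powr 1 * real (card {k. 1 \<le> k \<and> real k \<le> real n \<and>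
        (\<exists>x\<in>{0..1}. 1 * fuzzy_dist (fs k x) (f x) \<ge> 1)})) \<longlonglongrightarrow> 0"
      unfolding WU_conv_def weight_sum_unit by (meson zero_less_one)
    have "\<exists>x\<in>{0..1}. 1 * fuzzy_dist (fs k x) (f x) \<ge> 1" if "1 \<le> k" for k
      using that by (intro bexI[of _ "1 / real k"])
        (simp_all add: fs_def f_def P_def fuzzy_dist_indicator_singleton)
    then have "{k. 1 \<le> k \<and> real k \<le> real n \<and>
        (\<exists>x\<in>{0..1}. 1 * fuzzy_dist (fs k x) (f x) \<ge> 1)} = {1..n}" for n
      by auto
    with lim have lim': "(\<lambda>n. 1 / real n powr 1 * real n) \<longlonglongrightarrow> 0" by simp
    \<comment> \<open>Only eventually: at \<open>n = 0\<close> division by zero makes the quotient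
      0.\<close>
    have "\<forall>\<^sub>F n in sequentially. 1 / real n powr 1 * real n = 1"
      using eventually_gt_at_top[of 0] by eventually_elim simp
    with lim' have "(\<lambda>n. 1 :: real) \<longlonglongrightarrow> 0"
      by (rule Lim_transform_eventually)
    then show False by (simp add: LIMSEQ_const_iff)
  qed
qed

text \<open>The condition \<open>0 < x\<close> keeps 0 free of spikes; otherwise every index would
  be exceptional there and pointwise convergence would fail.\<close>

lemma WP_conv_not_WE_conv_example:
  fixes P :: "nat \<Rightarrow> real \<Rightarrow> bool"
  defines "P \<equiv> \<lambda>k x. 0 < x \<and> x * real k \<le> 1"
  defines "fs \<equiv> \<lambda>k x. indicator {of_bool (P k x)}" and "f \<equiv> \<lambda>x::real. indicator {0}"
  shows "WP_conv 1 (\<lambda>_. 1) real (\<lambda>_. 1) 0 1 fs f"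
    and "\<not> WE_conv 1 (\<lambda>_. 1) real (\<lambda>_. 1) 0 1 fs f"
proof -
  show "WP_conv 1 (\<lambda>_. 1) real (\<lambda>_. 1) 0 1 fs f"
    unfolding WP_conv_def weight_sum_unit
  proof (intro allI impI ballI)
    fix \<epsilon> x :: real assume "\<epsilon> > 0" "x \<in> {0..1}"
    let ?E = "\<lambda>n. {k. 1 \<le> k \<and> real k \<le> real n \<and> 1 * fuzzy_dist (fs k x) (f x) \<ge> \<epsilon>}"
    let ?S = "{k. P k x}"
    have "finite ?S"
    proof (cases "0 < x")
      case True
      then have "?S = {k. real k \<le> 1 / x}" by (auto simp: P_def field_simps)
      then show ?thesis using finite_real_nat_atMost by simp
    qed (simp add: P_def)
    moreover have "?E n \<subseteq> ?S" for n
      by (auto simp: fs_def f_def fuzzy_dist_crisp_ge_iff[OF \<open>\<epsilon> > 0\<close>])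
    ultimately have "card (?E n) \<le> card ?S" for n
      by (rule card_mono)
    \<comment> \<open>The numerator is now a constant depending on \<open>x\<close> alone, of size
      about \<open>1 / x\<close>, which is why the decay is not uniform.\<close>
    then have "norm (1 / real n powr 1 * real (card (?E n))) \<le> real (card ?S) / real n" for n
      by (simp add: divide_right_mono)
    then show "(\<lambda>n. 1 / real n powr 1 * real (card (?E n))) \<longlonglongrightarrow> 0"
      by (intro Lim_null_comparison[OF _ lim_const_over_n] always_eventually allI)
  qed
  show "\<not> WE_conv 1 (\<lambda>_. 1) real (\<lambda>_. 1) 0 1 fs f"
  proof
    let ?S = "\<lambda>m x. 1 / real m powr 1 *
      real (card {k. 1 \<le> k \<and> real k \<le> real m \<and> 1 * fuzzy_dist (fs k x) (f x) \<ge> 1})"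
    assume "WE_conv 1 (\<lambda>_. 1) real (\<lambda>_. 1) 0 1 fs f"
    then have "uniform_limit {0..1} ?S (\<lambda>x. 0) sequentially"
      unfolding WE_conv_def weight_sum_unit by (meson zero_less_one)
    then have "\<forall>\<^sub>F m in sequentially. \<forall>x\<in>{0..1}. dist (?S m x) 0 < 1"
      unfolding uniform_limit_iff by (meson zero_less_one)
    \<comment> \<open>Positivity of \<open>m\<close> is needed for the witness \<open>1 / m\<close>
      to lie in the spikes, as \<open>1 / 0\<close> is 0.\<close>
    then have "\<forall>\<^sub>F m in sequentially. m > 0 \<and> (\<forall>x\<in>{0..1}. dist (?S m x) 0 < 1)"
      using eventually_gt_at_top[of 0] by eventually_elim blast
    then obtain m where m: "m > 0" "\<And>x. x \<in> {0..1} \<Longrightarrow> dist (?S m x) 0 < 1"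
      using eventually_happens'[OF sequentially_bot] by blast
    \<comment> \<open>At \<open>x = 1 / m\<close> the spike condition \<open>x * k \<le> 1\<close>
      reads \<open>k \<le> m\<close>, so every counted index is exceptional and the density is
      exactly 1.\<close>
    have "1 * fuzzy_dist (fs k (1 / real m)) (f (1 / real m)) \<ge> 1" if "k \<le> m" for k
      using that m(1) by (simp add: fs_def f_def P_def fuzzy_dist_indicator_singleton)
    then have "{k. 1 \<le> k \<and> real k \<le> real m \<and>
        1 * fuzzy_dist (fs k (1 / real m)) (f (1 / real m)) \<ge> 1} = {1..m}"
      by auto
    then have "?S m (1 / real m) = 1" using m(1) by simp
    then show False using m(1) m(2)[of "1 / real m"] by simp
  qed
qed

theorem theorem3p5:
  shows "(\<forall>\<theta> \<alpha> \<beta> t a b fs f. fuzzy_setting \<theta> \<alpha> \<beta> t a b fs f \<longrightarrow>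
            (WU_conv \<theta> \<alpha> \<beta> t a b fs f \<longrightarrow> WE_conv \<theta> \<alpha> \<beta> t a b fs f) \<and>
            (WE_conv \<theta> \<alpha> \<beta> t a b fs f \<longrightarrow> WP_conv \<theta> \<alpha> \<beta> t a b fs f)) \<and>
         (\<exists>\<theta> \<alpha> \<beta> t a b fs f. fuzzy_setting \<theta> \<alpha> \<beta> t a b fs f \<and>
            WE_conv \<theta> \<alpha> \<beta> t a b fs f \<and> \<not> WU_conv \<theta> \<alpha> \<beta> t a b fs f) \<and>
         (\<exists>\<theta> \<alpha> \<beta> t a b fs f. fuzzy_setting \<theta> \<alpha> \<beta> t a b fs f \<and>
            WP_conv \<theta> \<alpha> \<beta> t a b fs f \<and> \<not> WE_conv \<theta> \<alpha> \<beta> t a b fs f)"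
proof (intro conjI)
  show "\<forall>\<theta> \<alpha> \<beta> t a b fs f. fuzzy_setting \<theta> \<alpha> \<beta> t a b fs f \<longrightarrow>
      (WU_conv \<theta> \<alpha> \<beta> t a b fs f \<longrightarrow> WE_conv \<theta> \<alpha> \<beta> t a b fs f) \<and>
      (WE_conv \<theta> \<alpha> \<beta> t a b fs f \<longrightarrow> WP_conv \<theta> \<alpha> \<beta> t a b fs f)"
    using WU_conv_imp_WE_conv WE_conv_imp_WP_conv by blast
  show "\<exists>\<theta> \<alpha> \<beta> t a b fs f. fuzzy_setting \<theta> \<alpha> \<beta> t a b fs f \<and>
      WE_conv \<theta> \<alpha> \<beta> t a b fs f \<and> \<not> WU_conv \<theta> \<alpha> \<beta> t a b fs f"
    \<comment> \<open>The witnesses start out schematic: the setting lemma fixes all but the spike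
      predicate, which unification with the example supplies.\<close>
    by (intro exI conjI, rule fuzzy_setting_unit_crisp, rule WE_conv_not_WU_conv_example(1),
        rule WE_conv_not_WU_conv_example(2))
  show "\<exists>\<theta> \<alpha> \<beta> t a b fs f. fuzzy_setting \<theta> \<alpha> \<beta> t a b fs f \<and>
      WP_conv \<theta> \<alpha> \<beta> t a b fs f \<and> \<not> WE_conv \<theta> \<alpha> \<beta> t a b fs f"
    by (intro exI conjI, rule fuzzy_setting_unit_crisp, rule WP_conv_not_WE_conv_example(1),
        rule WP_conv_not_WE_conv_example(2))
qed

end
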